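(* Let $X$ be a non-negative random variable with absolutely continuous distribution function $F$ and finite mean, and let $v>0$, $v\neq1$, be such that $\mathcal{M}_{1,0,v-1}$ exists (is finite). Then the absolute S-Gini index $S_v$ of $X$ satisfies $$S_v=\frac1v\mathcal{M}_{1,0,0}-\mathcal{M}_{1,0,v-1}.$$
   Context: $\bar F(x)=1-F(x)=P(X>x)$. The absolute S-Gini index is $S_v=-\mathrm{Cov}(X,\bar F^{v-1}(X))$, where $\mathrm{Cov}(A,B)=E(AB)-E(A)E(B)$. For real $p,r,s$ for which the expectation exists, the probability weighted moment of $X$ is $\mathcal{M}_{p,r,s}=E\{X^pF^r(X)(1-F(X))^s\}$. *)

theory Defs
  imports "HOL-Probability.Probability"
begin

(* The library's absolutely_continuous relates two measures; this is the epsilon-delta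
   notion for a point function on the real line. *)
definition abs_continuous_fun :: "(real \<Rightarrow> real) \<Rightarrow> bool" where
  "abs_continuous_fun F \<longleftrightarrow>
     (\<forall>\<epsilon>>0. \<exists>\<delta>>0. \<forall>(n::nat) (a::nat \<Rightarrow> real) (b::nat \<Rightarrow> real).
        (\<forall>i<n. a i < b i) \<and> disjoint_family_on (\<lambda>i. {a i<..<b i}) {..<n} \<and>
        (\<Sum>i<n. b i - a i) < \<delta>
        \<longrightarrow> (\<Sum>i<n. \<bar>F (b i) - F (a i)\<bar>) < \<epsilon>)"

(* Real powers of a non-negative base with the convention x^0 = 1; in the library 0 powr 0 = 0.
   For a < 0 the power of 0 is mathematically undefined; here it has the value 0. *)
definition rpow :: "real \<Rightarrow> real \<Rightarrow> real" where
  "rpow x a = (if a = 0 then 1 else x powr a)"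

definition dist_fun :: "'a measure \<Rightarrow> ('a \<Rightarrow> real) \<Rightarrow> real \<Rightarrow> real" where
  "dist_fun M X = cdf (distr M borel X)"

definition survival_fun :: "'a measure \<Rightarrow> ('a \<Rightarrow> real) \<Rightarrow> real \<Rightarrow> real" where
  "survival_fun M X x = 1 - dist_fun M X x"

definition covariance :: "'a measure \<Rightarrow> ('a \<Rightarrow> real) \<Rightarrow> ('a \<Rightarrow> real) \<Rightarrow> real" where
  "covariance M A B =
     (LINT \<omega>|M. A \<omega> * B \<omega>) - (LINT \<omega>|M. A \<omega>) * (LINT \<omega>|M. B \<omega>)"

definition abs_S_Gini :: "'a measure \<Rightarrow> ('a \<Rightarrow> real) \<Rightarrow> real \<Rightarrow> real" where
  "abs_S_Gini M X v = - covariance M X (\<lambda>\<omega>. rpow (survival_fun M X (X \<omega>)) (v - 1))"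

(* Intended for non-negative X, since the exponent p is real. *)
definition pwm_integrand ::
  "'a measure \<Rightarrow> ('a \<Rightarrow> real) \<Rightarrow> real \<Rightarrow> real \<Rightarrow> real \<Rightarrow> 'a \<Rightarrow> real" where
  "pwm_integrand M X p r s \<omega> =
     rpow (X \<omega>) p * rpow (dist_fun M X (X \<omega>)) r * rpow (1 - dist_fun M X (X \<omega>)) s"

definition pwm_exists :: "'a measure \<Rightarrow> ('a \<Rightarrow> real) \<Rightarrow> real \<Rightarrow> real \<Rightarrow> real \<Rightarrow> bool" where
  "pwm_exists M X p r s \<longleftrightarrow> integrable M (pwm_integrand M X p r s)"

definition pwm :: "'a measure \<Rightarrow> ('a \<Rightarrow> real) \<Rightarrow> real \<Rightarrow> real \<Rightarrow> real \<Rightarrow> real" where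
  "pwm M X p r s = integral\<^sup>L M (pwm_integrand M X p r s)"

end

(* By the probability integral transform the survival function of a continuous distribution,
   evaluated at X, is uniform on (0,1). Hence E (1 - F(X))^(v-1) = 1/v, and the identity is the
   definition of the covariance. *)
theory Submission
  imports Defs
begin

text \<open>Families consisting of a single interval already give the epsilon-delta condition at a
  point; the interval lies to the right or to the left of \<open>x\<close>.\<close>

lemma abs_continuous_fun_imp_isCont:
  assumes "abs_continuous_fun F"
  shows "isCont F x"
proof -
  have "\<exists>\<delta>>0. \<forall>y. \<bar>y - x\<bar> < \<delta> \<longrightarrow> \<bar>F y - F x\<bar> < \<epsilon>" if "\<epsilon> > 0" for \<epsilon>
  proof -
    obtain \<delta> where "\<delta> > 0" and \<delta>: "\<forall>(n::nat) a b.
        (\<forall>i<n. a i < b i) \<and> disjoint_family_on (\<lambda>i. {a i<..<b i}) {..<n} \<and>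
        (\<Sum>i<n. b i - a i) < \<delta> \<longrightarrow> (\<Sum>i<n. \<bar>F (b i) - F (a i)\<bar>) < \<epsilon>"
      using assms[unfolded abs_continuous_fun_def, THEN spec, THEN mp, OF \<open>\<epsilon> > 0\<close>]
      by (elim exE conjE) (rule that)
    have step: "\<bar>F b - F a\<bar> < \<epsilon>" if "a < b" "b - a < \<delta>" for a b
      using \<delta>[THEN spec[of _ 1], THEN spec[of _ "\<lambda>_. a"], THEN spec[of _ "\<lambda>_. b"]] that
      by (simp add: disjoint_family_on_def)
    have "\<bar>F y - F x\<bar> < \<epsilon>" if "\<bar>y - x\<bar> < \<delta>" for y
      using step[of x y] step[of y x] that \<open>\<epsilon> > 0\<close>
      by (cases x y rule: linorder_cases) (auto simp: abs_minus_commute)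
    with \<open>\<delta> > 0\<close> show ?thesis by blast
  qed
  then show ?thesis
    unfolding continuous_at_eps_delta dist_real_def by blast
qed

context cdf_distribution
begin

text \<open>\<open>I\<close> is the quantile function: \<open>u \<le> C x\<close> iff
  \<open>I u \<le> x\<close>. So \<open>C\<close> stays below \<open>u\<close> to the left of
  \<open>I u\<close>, and continuity there excludes a jump past \<open>u\<close>.\<close>

lemma cdf_I:
  assumes "isCont C (I u)" and "0 < u" "u < 1"
  shows "C (I u) = u"
proof (rule antisym)
  show "u \<le> C (I u)"
    by (rule iffD2[OF pseudoinverse[OF assms(2,3)] order_refl])
  have "(C \<longlongrightarrow> C (I u)) (at_left (I u))"
    using assms(1) unfolding isCont_def by (rule tendsto_within_subset) simp
  moreover have "\<forall>\<^sub>F x in at_left (I u). C x \<le> u"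
  proof -
    have "C x \<le> u" if "x < I u" for x
      using iffD1[OF pseudoinverse[OF assms(2,3)], of x] that by linarith
    then show ?thesis
      by (simp add: eventually_at_filter)
  qed
  ultimately show "C (I u) \<le> u"
    by (rule tendsto_upperbound) simp
qed

text \<open>Probability integral transform: the distribution is the image of the uniform law on
  (0,1) under \<open>I\<close>, and \<open>C\<close> undoes \<open>I\<close> by
  \<open>cdf_I\<close>.\<close>

lemma integral_cdf:
  fixes g :: "real \<Rightarrow> real"
  assumes "\<And>x. isCont C x" and [measurable]: "g \<in> borel_measurable borel"
  shows "(LINT x|M. g (C x)) = (LINT u:{0<..<1}|lborel. g u)"
proof -
  let ?U = "restrict_space lborel {0<..<1::real}"
  have "(LINT x|M. g (C x)) = (LINT x|distr ?U borel I. g (C x))"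
    by (simp only: distr_I_eq_M)
  also have "\<dots> = (LINT u|?U. g (C (I u)))"
    by (rule integral_distr) auto
  also have "\<dots> = (LINT u|?U. g u)"
    by (rule Bochner_Integration.integral_cong) (auto simp: space_restrict_space cdf_I assms(1))
  also have "\<dots> = (LINT u:{0<..<1}|lborel. g u)"
    by (simp add: integral_restrict_space set_lebesgue_integral_def)
  finally show ?thesis .
qed

end

lemma integral_one_minus_powr:
  fixes v :: real
  assumes "v > 0"
  shows "(LINT u:{0<..<1}|lborel. (1 - u) powr (v - 1)) = 1 / v"
proof -
  let ?F = "\<lambda>u::real. - ((1 - u) powr v / v)"
  \<comment> \<open>At \<open>c = 1\<close> the base of the power tends to 0. The limit then rests
    on \<open>v > 0\<close> and on approaching from the left, where the base is
    non-negative.\<close>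
  have lim: "(?F \<longlongrightarrow> ?F c) (at c within A)" if "c \<noteq> 1 \<or> A \<subseteq> {..1}" for c A
  proof -
    have "((\<lambda>u. (1 - u) powr v) \<longlongrightarrow> (1 - c) powr v) (at c within A)"
    proof (cases "c = 1")
      case True
      with that assms show ?thesis
        by (intro tendsto_powr2 tendsto_diff tendsto_const tendsto_ident_at)
          (auto simp: eventually_at_filter intro!: always_eventually)
    next
      case False
      then show ?thesis
        by (intro tendsto_powr tendsto_diff tendsto_const tendsto_ident_at) auto
    qed
    from tendsto_minus[OF tendsto_divide[OF this tendsto_const[of v]]] show ?thesis
      using assms by simp
  qed
  have "(LBINT u=ereal 0..ereal 1. (1 - u) powr (v - 1)) = ?F 1 - ?F 0"
  \<comment> \<open>For \<open>v < 1\<close> the integrand is unbounded near 1. This version for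
    non-negative integrands asks for the derivative only inside the interval and for limits of
    \<open>?F\<close> at its ends.\<close>
  proof (intro interval_integral_FTC_nonneg(2))
    fix x :: real
    assume "ereal x < ereal 1"
    then have "x < 1" by simp
    then show "DERIV ?F x :> (1 - x) powr (v - 1)"
      using assms by (auto intro!: derivative_eq_intros)
    show "isCont (\<lambda>u. (1 - u) powr (v - 1)) x"
      using \<open>x < 1\<close> by (intro continuous_intros) auto
  next
    show "((?F \<circ> real_of_ereal) \<longlongrightarrow> ?F 0) (at_right (ereal 0))"
      unfolding ereal_tendsto_simps1 by (rule lim) simp
    show "((?F \<circ> real_of_ereal) \<longlongrightarrow> ?F 1) (at_left (ereal 1))"
      unfolding ereal_tendsto_simps1 by (rule lim) auto
  qed simp_all
  then show ?thesis
    by (simp add: interval_integral_Ioo)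
qed

lemma (in prob_space) expectation_survival_powr:
  fixes v :: real
  assumes [measurable]: "random_variable borel X"
    and "\<And>x. isCont (dist_fun M X) x" and "v > 0"
  shows "expectation (\<lambda>\<omega>. survival_fun M X (X \<omega>) powr (v - 1)) = 1 / v"
proof -
  interpret D: cdf_distribution "distr M borel X"
    unfolding cdf_distribution_def by simp
  have "expectation (\<lambda>\<omega>. survival_fun M X (X \<omega>) powr (v - 1))
      = (LINT x|distr M borel X. (1 - D.C x) powr (v - 1))"
    unfolding survival_fun_def dist_fun_def by (rule integral_distr[symmetric]) auto
  also have "\<dots> = (LINT u:{0<..<1}|lborel. (1 - u) powr (v - 1))"
    by (rule D.integral_cdf) (use assms(2) in \<open>auto simp: dist_fun_def\<close>)
  finally show ?thesis
    using integral_one_minus_powr[OF \<open>v > 0\<close>] by simp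
qed

text \<open>The factor with exponent 0 is 1 even where the distribution function vanishes, by the
  convention in \<open>rpow\<close>. The first power of \<open>X\<close> is \<open>X\<close> only
  where \<open>X\<close> is non-negative, hence almost everywhere.\<close>

lemma pwm_1_0_eq:
  assumes [measurable]: "X \<in> borel_measurable M" and "AE \<omega> in M. 0 \<le> X \<omega>"
    and "prob_space M"
  shows "pwm M X 1 0 s = (LINT \<omega>|M. X \<omega> * rpow (survival_fun M X (X \<omega>)) s)"
proof -
  interpret prob_space M by fact
  interpret D: cdf_distribution "distr M borel X"
    unfolding cdf_distribution_def by simp
  have [measurable]: "dist_fun M X \<in> borel_measurable borel"
    unfolding dist_fun_def by simp
  show ?thesis
    unfolding pwm_def
  proof (rule integral_cong_AE)
    show "AE \<omega> in M. pwm_integrand M X 1 0 s \<omega> = X \<omega> * rpow (survival_fun M X (X \<omega>)) s"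
      using assms(2) by eventually_elim (simp add: pwm_integrand_def survival_fun_def rpow_def)
  qed (unfold pwm_integrand_def rpow_def survival_fun_def, measurable)
qed

theorem mainTheorem8:
  fixes M :: "'a measure" and X :: "'a \<Rightarrow> real" and v :: real
  assumes "prob_space M"
    and "X \<in> borel_measurable M"
    and "AE \<omega> in M. 0 \<le> X \<omega>"
    and "abs_continuous_fun (dist_fun M X)"
    and "integrable M X"
    and "v > 0" and "v \<noteq> 1"
    and "pwm_exists M X 1 0 (v - 1)"
  shows "abs_S_Gini M X v = (1 / v) * pwm M X 1 0 0 - pwm M X 1 0 (v - 1)"
proof -
  interpret prob_space M by fact
  \<comment> \<open>Since \<open>v \<noteq> 1\<close>, the exponent is nonzero and
    \<open>rpow\<close> is \<open>powr\<close>.\<close>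
  have "expectation (\<lambda>\<omega>. rpow (survival_fun M X (X \<omega>)) (v - 1)) = 1 / v"
    using expectation_survival_powr[OF assms(2) abs_continuous_fun_imp_isCont[OF assms(4)] \<open>v > 0\<close>]
      \<open>v \<noteq> 1\<close> by (simp add: rpow_def)
  moreover have "pwm M X 1 0 0 = expectation X"
    by (simp add: pwm_1_0_eq[OF assms(2,3,1)] rpow_def)
  \<comment> \<open>The expectation of the product in the covariance is
    \<open>pwm M X 1 0 (v - 1)\<close>, and the product of the expectations is the mean of
    \<open>X\<close> divided by \<open>v\<close>.\<close>
  ultimately show ?thesis
    by (simp add: abs_S_Gini_def covariance_def pwm_1_0_eq[OF assms(2,3,1)])
qed

end
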